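(* Let $\mathbb{F}$ be a field of characteristic different from $2$ and let $L$ be an $n$-dimensional nilpotent Lie algebra over $\mathbb{F}$ of coclass $2$ (that is, of nilpotency class $n-2$). Then $\mathcal{A}(L)$ is a subgroup of $Aut(L)$.
   Context: The lower central series is written $L\supseteq L^1=L'=[L,L]\supseteq L^2\supseteq\cdots$ with $L^{i+1}=[L,L^i]$ (and $L^0=L$). $L$ is nilpotent if $L^m=0$ for some $m$; the nilpotency class is the $c$ with $L^{c-1}\neq 0$ and $L^c=0$. If $L$ is nilpotent of dimension $n$ and nilpotency class $c$, its coclass is $n-c$. $Aut(L)$ is the group of Lie algebra automorphisms of $L$ under composition. The set of commuting automorphisms is $\mathcal{A}(L)=\{\alpha\in Aut(L) : [\alpha(x),x]=0\ \forall x\in L\}$. *)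

theory Defs
  imports Complex_Main "HOL-Algebra.Group"
begin

text \<open>
  A Lie algebra over the field \<open>'f\<close> whose underlying vector space is the whole type \<open>'v\<close>.
  The bracket is bilinear and alternating (which is stronger than skew-symmetric in
  characteristic 2) and satisfies the Jacobi identity.
\<close>
locale lie_algebra = vector_space scale
  for scale :: "'f::field \<Rightarrow> 'v::ab_group_add \<Rightarrow> 'v" +
  fixes bracket :: "'v \<Rightarrow> 'v \<Rightarrow> 'v"
  assumes linear_bracket_left: "Vector_Spaces.linear scale scale (\<lambda>x. bracket x y)"
    and linear_bracket_right: "Vector_Spaces.linear scale scale (\<lambda>y. bracket x y)"
    and bracket_self: "bracket x x = 0"
    and jacobi: "bracket x (bracket y z) + bracket y (bracket z x) + bracket z (bracket x y) = 0"
begin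

definition has_dimension :: "nat \<Rightarrow> bool" where
  "has_dimension n \<longleftrightarrow> (\<exists>B. finite B \<and> independent B \<and> span B = UNIV \<and> card B = n)"

definition bracket_span :: "'v set \<Rightarrow> 'v set \<Rightarrow> 'v set" where
  "bracket_span U V = span {bracket x y | x y. x \<in> U \<and> y \<in> V}"

text \<open>The indexing starts with \<open>L\<^sup>0 = L\<close>, so that \<open>L\<^sup>1\<close> is the derived algebra.\<close>
primrec lower_central :: "nat \<Rightarrow> 'v set" where
  "lower_central 0 = UNIV"
| "lower_central (Suc i) = bracket_span UNIV (lower_central i)"

definition nilpotent :: bool where
  "nilpotent \<longleftrightarrow> (\<exists>m. lower_central m = {0})"

text \<open>
  For \<open>c = 0\<close> truncated subtraction makes the two conjuncts contradictory, so a class is always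
  positive; the zero algebra has none.
\<close>
definition has_nilpotency_class :: "nat \<Rightarrow> bool" where
  "has_nilpotency_class c \<longleftrightarrow> lower_central (c - 1) \<noteq> {0} \<and> lower_central c = {0}"

text \<open>Stated additively instead of as \<open>k = n - c\<close> to avoid truncated subtraction.\<close>
definition has_coclass :: "nat \<Rightarrow> bool" where
  "has_coclass k \<longleftrightarrow> (\<exists>n c. has_dimension n \<and> has_nilpotency_class c \<and> n = c + k)"

definition automorphisms :: "('v \<Rightarrow> 'v) set" where
  "automorphisms = {\<alpha>. Vector_Spaces.linear scale scale \<alpha> \<and> bij \<alpha> \<and>
     (\<forall>x y. \<alpha> (bracket x y) = bracket (\<alpha> x) (\<alpha> y))}"

definition automorphism_group :: "('v \<Rightarrow> 'v) monoid" where
  "automorphism_group = \<lparr>carrier = automorphisms, mult = (\<circ>), one = id\<rparr>"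

definition commuting_automorphisms :: "('v \<Rightarrow> 'v) set" where
  "commuting_automorphisms = {\<alpha> \<in> automorphisms. \<forall>x. bracket (\<alpha> x) x = 0}"

lemma dim_unique: "has_dimension n \<Longrightarrow> dim UNIV = n"
  unfolding has_dimension_def by (metis dim_eq_card span_UNIV)

lemma lower_central_Suc_subset: "lower_central (Suc i) \<subseteq> lower_central i"
proof (induction i)
  case (Suc i)
  then show ?case
    by (simp only: lower_central.simps(2) bracket_span_def) (intro span_mono, blast)
qed simp

lemma nilpotency_class_unique:
  assumes "has_nilpotency_class c" "has_nilpotency_class d"
  shows "c = d"
proof -
  have anti: "lower_central j \<subseteq> lower_central i" if "i \<le> j" for i j
    using that lower_central_Suc_subset by (rule lift_Suc_antimono_le[rotated])
  have zero: "0 \<in> lower_central i" for i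
    by (cases i) (auto simp: bracket_span_def intro: span_zero)
  have "\<not> a < b" if "has_nilpotency_class a" "has_nilpotency_class b" for a b
  proof
    assume "a < b"
    then have "lower_central (b - 1) \<subseteq> {0}"
      using that(1) anti[of a "b - 1"] by (simp add: has_nilpotency_class_def)
    with that(2) zero show False unfolding has_nilpotency_class_def by blast
  qed
  with assms show ?thesis by (meson linorder_neqE_nat)
qed

lemma automorphisms_inv:
  assumes "\<alpha> \<in> automorphisms"
  shows "inv_into UNIV \<alpha> \<in> automorphisms"
proof -
  interpret a: Vector_Spaces.linear scale scale \<alpha>
    using assms by (simp add: automorphisms_def)
  have bij: "bij \<alpha>" and br: "\<And>x y. \<alpha> (bracket x y) = bracket (\<alpha> x) (\<alpha> y)"
    using assms by (auto simp: automorphisms_def)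
  have inv: "inv_into UNIV \<alpha> y = x \<longleftrightarrow> y = \<alpha> x" for x y
    using bij by (metis bij_inv_eq_iff)
  have right: "\<alpha> (inv_into UNIV \<alpha> y) = y" for y
    using inv by metis
  have "Vector_Spaces.linear scale scale (inv_into UNIV \<alpha>)"
    by unfold_locales (simp_all add: inv right a.add a.scale)
  moreover have "inv_into UNIV \<alpha> (bracket x y) = bracket (inv_into UNIV \<alpha> x) (inv_into UNIV \<alpha> y)" for x y
    by (simp add: inv right br)
  ultimately show ?thesis
    using bij by (simp add: automorphisms_def bij_imp_bij_inv)
qed

lemma group_automorphism_group: "group automorphism_group"
proof (rule groupI)
  show "\<exists>y\<in>carrier automorphism_group. y \<otimes>\<^bsub>automorphism_group\<^esub> x = \<one>\<^bsub>automorphism_group\<^esub>"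
    if "x \<in> carrier automorphism_group" for x
    using that automorphisms_inv[of x]
    by (intro bexI[of _ "inv_into UNIV x"])
      (auto simp: automorphism_group_def automorphisms_def bij_is_inj)
  show "x \<otimes>\<^bsub>automorphism_group\<^esub> y \<in> carrier automorphism_group"
    if "x \<in> carrier automorphism_group" "y \<in> carrier automorphism_group" for x y
    using that
    by (auto simp: automorphism_group_def automorphisms_def bij_comp
      intro: Vector_Spaces.linear_compose)
  show "\<one>\<^bsub>automorphism_group\<^esub> \<in> carrier automorphism_group"
    by (simp add: automorphism_group_def automorphisms_def linear_id)
qed (auto simp: automorphism_group_def o_assoc)

end

end

theory Submission
  imports Defs
begin

text \<open>
  Write a commuting automorphism as \<open>\<alpha> = 1 + D\<close>. Polarising \<open>[\<alpha> x, x] = 0\<close> makes \<open>D\<close>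
  self-adjoint for the bracket, the values of \<open>D\<close> are right 2-Engel elements, and in
  characteristic \<open>\<noteq> 2\<close> this forces \<open>[[D x, y], z] = 0\<close>, whence \<open>[D x, L'] = 0\<close>. If
  \<open>\<beta> = 1 + E\<close> is another commuting automorphism, then \<open>\<alpha> \<circ> \<beta>\<close> is commuting as soon as
  \<open>[D x, E x] = 0\<close> for all \<open>x\<close>.

  If \<open>L\<close> has coclass \<open>2\<close> and is not abelian, a dimension count gives \<open>L' = \<langle>[p, q]\<rangle> + L\<^sup>2\<close> and \<open>L = \<langle>p, q, w\<rangle> + L'\<close> with
  \<open>[w, L] \<subseteq> L\<^sup>2\<close>. Self-adjointness then yields a scalar \<open>r\<close> such that \<open>D - r\<close> maps into
  \<open>\<langle>w\<rangle> + L'\<close>. If \<open>r \<noteq> 0\<close> then \<open>L\<^sup>2 = 0\<close> and \<open>[D x, y] = r [x, y]\<close>, so \<open>[D x, E x] = r [x, E x] = 0\<close>;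
  similarly for \<open>E\<close>. If both scalars vanish, \<open>D x\<close> and \<open>E x\<close> are dependent modulo \<open>L'\<close>,
  which they centralise.
\<close>

context lie_algebra
begin

section \<open>Bracket calculus\<close>

lemma bracket_add_left: "bracket (x + y) z = bracket x z + bracket y z"
proof -
  interpret l: Vector_Spaces.linear scale scale "\<lambda>x. bracket x z" by (rule linear_bracket_left)
  show ?thesis by (rule l.add)
qed

lemma bracket_add_right: "bracket z (x + y) = bracket z x + bracket z y"
proof -
  interpret l: Vector_Spaces.linear scale scale "bracket z" by (rule linear_bracket_right)
  show ?thesis by (rule l.add)
qed

lemma bracket_scale_left: "bracket (scale a x) z = scale a (bracket x z)"
proof -
  interpret l: Vector_Spaces.linear scale scale "\<lambda>x. bracket x z" by (rule linear_bracket_left)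
  show ?thesis by (rule l.scale)
qed

lemma bracket_scale_right: "bracket z (scale a x) = scale a (bracket z x)"
proof -
  interpret l: Vector_Spaces.linear scale scale "bracket z" by (rule linear_bracket_right)
  show ?thesis by (rule l.scale)
qed

lemma bracket_zero_left [simp]: "bracket 0 x = 0"
  using bracket_scale_left[of 0 0 x] by simp

lemma bracket_zero_right [simp]: "bracket x 0 = 0"
  using bracket_scale_right[of x 0 0] by simp

lemma bracket_minus_left: "bracket (- x) y = - bracket x y"
  using bracket_add_left[of x "- x" y] by (simp add: eq_neg_iff_add_eq_0 add.commute)

lemma bracket_minus_right: "bracket y (- x) = - bracket y x"
  using bracket_add_right[of y x "- x"] by (simp add: eq_neg_iff_add_eq_0 add.commute)

lemma bracket_diff_left: "bracket (x - y) z = bracket x z - bracket y z"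
  using bracket_add_left[of x "- y" z] by (simp add: bracket_minus_left)

lemma bracket_diff_right: "bracket z (x - y) = bracket z x - bracket z y"
  using bracket_add_right[of z x "- y"] by (simp add: bracket_minus_right)

lemmas bracket_simps = bracket_add_left bracket_add_right bracket_scale_left bracket_scale_right
  bracket_diff_left bracket_diff_right bracket_minus_left bracket_minus_right bracket_self

lemma bracket_skew: "bracket x y = - bracket y x"
proof -
  have "bracket (x + y) (x + y) = bracket x y + bracket y x"
    unfolding bracket_add_left bracket_add_right by (simp add: bracket_self)
  then show ?thesis by (simp only: bracket_self eq_neg_iff_add_eq_0)
qed

text \<open>The Jacobi identity in derivation form: bracketing with \<open>z\<close> on the right
  obeys the Leibniz rule. This is the shape in which nested brackets are reordered below.\<close>

lemma bracket_bracket: "bracket (bracket x y) z = bracket (bracket x z) y + bracket x (bracket y z)"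
proof -
  have "bracket y (bracket z x) = bracket (bracket x z) y"
    using bracket_skew[of y "bracket z x"] bracket_skew[of z x] by (simp add: bracket_minus_left)
  moreover have "bracket z (bracket x y) = - bracket (bracket x y) z" by (rule bracket_skew)
  ultimately show ?thesis using jacobi[of x y z] by (simp add: algebra_simps)
qed

lemma double_eq_zero:
  fixes v :: 'v
  assumes "(2::'f) \<noteq> 0" and "v + v = 0"
  shows "v = 0"
proof -
  have "scale 2 v = v + v" using scale_left_distrib[of 1 1 v] by simp
  with assms show ?thesis by simp
qed

section \<open>The lower central series\<close>

lemma subspace_lower_central: "subspace (lower_central i)"
  by (cases i) (simp_all add: bracket_span_def subspace_UNIV)

lemma bracket_mem_right: "l \<in> lower_central i \<Longrightarrow> bracket x l \<in> lower_central (Suc i)"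
  by (auto simp: bracket_span_def intro!: span_base)

lemma bracket_mem_left: "l \<in> lower_central i \<Longrightarrow> bracket l x \<in> lower_central (Suc i)"
  using bracket_mem_right[of l i x] bracket_skew[of l x] subspace_neg[OF subspace_lower_central]
  by metis

lemma bracket_mem_derived: "bracket x y \<in> lower_central (Suc 0)"
  by (rule bracket_mem_right) simp

lemma lower_central_Suc_least:
  assumes "subspace S" and "\<And>x l. l \<in> lower_central i \<Longrightarrow> bracket x l \<in> S"
  shows "lower_central (Suc i) \<subseteq> S"
  unfolding lower_central.simps bracket_span_def
  by (rule span_minimal) (use assms in auto)

lemma zero_in_lower_central: "0 \<in> lower_central i"
  by (rule subspace_0[OF subspace_lower_central])

lemma lower_central_antimono: "i \<le> j \<Longrightarrow> lower_central j \<subseteq> lower_central i"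
  by (rule lift_Suc_antimono_le[of lower_central, OF lower_central_Suc_subset])

text \<open>Once two consecutive terms agree, the series is constant from there on, so it must
  already have reached its final value 0.\<close>

lemma lower_central_stable:
  assumes "lower_central c = {0}" and "lower_central i \<subseteq> lower_central (Suc i)"
  shows "lower_central i = {0}"
proof -
  have eq: "lower_central (Suc i) = lower_central i"
    using assms(2) lower_central_Suc_subset by blast
  have "lower_central (i + k) = lower_central i" for k
  proof (induction k)
    case (Suc k)
    then show ?case using eq by simp
  qed simp
  then have "lower_central i = lower_central (i + c)" by simp
  also have "\<dots> \<subseteq> {0}" using lower_central_antimono[of c "i + c"] assms(1) by simp
  finally show ?thesis using zero_in_lower_central by blast
qed

section \<open>Self-adjointness and displacements of commuting automorphisms\<close>

lemma commuting_adjoint: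
  assumes "\<alpha> \<in> commuting_automorphisms"
  shows "bracket (\<alpha> x) y = bracket x (\<alpha> y)"
proof -
  interpret a: Vector_Spaces.linear scale scale \<alpha>
    using assms by (simp add: commuting_automorphisms_def automorphisms_def)
  have c: "bracket (\<alpha> x) x = 0" for x using assms by (simp add: commuting_automorphisms_def)
  have "bracket (\<alpha> x) y + bracket (\<alpha> y) x = 0"
    using c[of "x + y"] by (simp add: a.add bracket_simps c add.commute)
  then show ?thesis using bracket_skew[of "\<alpha> y" x] by simp
qed

text \<open>With \<open>D\<close> = \<alpha> - 1, the trilinear map \<open>\<phi> x y z\<close> =
  [[D x, y], z] turns out to change sign under swapping neighbouring arguments. Two linear relations
  between \<phi> and its twist by \<open>D\<close> then give 4 \<phi> = 0. There is no division by
  3, so characteristic 3 is covered as well.\<close>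

lemma commuting_displacement:
  assumes two: "(2::'f) \<noteq> 0" and \<alpha>: "\<alpha> \<in> commuting_automorphisms"
  shows "bracket (bracket (\<alpha> x - x) y) z = 0" and "bracket (\<alpha> x - x) (bracket y z) = 0"
proof -
  interpret a: Vector_Spaces.linear scale scale \<alpha>
    using \<alpha> by (simp add: commuting_automorphisms_def automorphisms_def)
  have hom: "\<alpha> (bracket x y) = bracket (\<alpha> x) (\<alpha> y)" for x y
    using \<alpha> by (auto simp: commuting_automorphisms_def automorphisms_def)
  have surj: "\<exists>x. y = \<alpha> x" for y
    using \<alpha> by (auto simp: commuting_automorphisms_def automorphisms_def dest!: bij_is_surj)
  have adj: "bracket (\<alpha> x) y = bracket x (\<alpha> y)" for x y by (rule commuting_adjoint[OF \<alpha>])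
  have comm: "bracket x (\<alpha> x) = 0" for x
    using \<alpha> adj[of x x] by (simp add: commuting_automorphisms_def)
  define D where "D x = \<alpha> x - x" for x
  have \<alpha>D: "\<alpha> x = x + D x" for x by (simp add: D_def)
  have Dadd: "D (x + y) = D x + D y" for x y by (simp add: D_def a.add)
  have Dadj: "bracket (D x) y = bracket x (D y)" for x y by (simp add: D_def bracket_simps adj)
  have Dskew: "bracket (D x) y = - bracket (D y) x" for x y
    using Dadj[of x y] bracket_skew[of x "D y"] by simp
  \<comment> \<open>Evaluate \<open>[[x, y], \<alpha> x]\<close> once through \<open>\<alpha>[x, y] = [x, \<alpha>\<^sup>2 y]\<close> and once through Jacobi.\<close>
  have engel: "bracket (bracket (D y) x) x = 0" for x y
  proof -
    obtain v where v: "y = \<alpha> v" using surj by blast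
    have "bracket (bracket x v) (\<alpha> x) = bracket (bracket x (\<alpha> y)) x"
      by (simp add: v adj[symmetric] hom)
    moreover have "bracket (bracket x v) (\<alpha> x) = bracket (bracket x y) x"
    proof -
      have "bracket (bracket x v) (\<alpha> x) = bracket x (bracket v (\<alpha> x))"
        using bracket_bracket[of x v "\<alpha> x"] comm[of x] by simp
      also have "bracket v (\<alpha> x) = - bracket x y"
        using adj[of v x] bracket_skew[of x y] v by simp
      finally show ?thesis using bracket_skew[of x "bracket x y"] by (simp add: bracket_simps)
    qed
    ultimately have "bracket (bracket x (D y)) x = 0" by (simp add: \<alpha>D bracket_simps)
    then show ?thesis using bracket_skew[of "D y" x] by (simp add: bracket_simps)
  qed
  define \<phi> where "\<phi> x y z = bracket (bracket (D x) y) z" for x y z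
  \<comment> \<open>Linearise \<open>engel\<close> in its repeated argument.\<close>
  have sk23: "\<phi> x y z = - \<phi> x z y" for x y z
    using engel[of x "y + z"] by (simp add: bracket_simps \<phi>_def engel eq_neg_iff_add_eq_0 add.commute)
  have sk12: "\<phi> x y z = - \<phi> y x z" for x y z
    unfolding \<phi>_def using Dskew[of x y] by (simp add: bracket_simps)
  have cyc: "\<phi> x y z = \<phi> z x y" for x y z
    using sk23[of x y z] sk12[of x z y] by simp
  have eng2: "bracket (D x) (bracket y z) = \<phi> x y z + \<phi> x y z" for x y z
    using bracket_bracket[of "D x" y z] sk23[of x y z] by (simp add: \<phi>_def algebra_simps)
  \<comment> \<open>Since \<alpha>[y, z] = [\<alpha> y, \<alpha> z] = [y, \<alpha>(\<alpha> z)], one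
    gets D[y, z] = [y, D(D z)] + 2[y, D z]. Bracket this with \<open>x\<close> and compare with [x,
    D[y, z]] = [D x, [y, z]] = 2 \<phi>(x, y, z).\<close>
  have D3: "\<phi> x y z + \<phi> x y z + \<phi> x y z + \<phi> x y z = - \<phi> (D x) y z" for x y z
  proof -
    have "D (bracket y z) = bracket y (\<alpha> (\<alpha> z)) - bracket y z"
      by (simp add: D_def hom adj)
    also have "\<dots> = bracket y (D (D z)) + bracket y (D z) + bracket y (D z)"
      by (simp add: \<alpha>D Dadd bracket_simps)
    finally have "bracket x (D (bracket y z)) = \<phi> (D z) y x + \<phi> z y x + \<phi> z y x"
      using bracket_skew[of x "bracket y (D z)"] bracket_skew[of y "D z"]
        bracket_skew[of x "bracket y (D (D z))"] bracket_skew[of y "D (D z)"]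
      by (simp add: bracket_simps \<phi>_def)
    then have "\<phi> x y z + \<phi> x y z = \<phi> (D z) y x + \<phi> z y x + \<phi> z y x"
      using Dadj[of x "bracket y z"] eng2 by simp
    moreover have "\<phi> z y x = - \<phi> x y z" using cyc[of x y z] sk23[of z x y] by simp
    moreover have "\<phi> (D z) y x = - \<phi> (D x) y z"
    proof -
      have "bracket (D (D z)) y = - bracket (D (D y)) z" for z y
        using Dadj[of "D z" y] Dadj[of z "D y"] bracket_skew[of z "D (D y)"] by simp
      then have "\<phi> (D z) x y = - \<phi> (D x) z y"
        unfolding \<phi>_def using bracket_minus_left by metis
      then show ?thesis using sk23[of "D z" y x] sk23[of "D x" z y] by simp
    qed
    ultimately show ?thesis by (simp add: eq_neg_iff_add_eq_0 ac_simps)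
  qed
  \<comment> \<open>Rotate \<open>D z\<close> into the last slot and apply \<open>eng2\<close>: the
    result is -2 \<phi>(z, D x, y). Self-adjointness moves \<open>D\<close> back onto
    \<open>D z\<close>, so the value equals -2 times itself.\<close>
  have D2: "\<phi> (D z) x y + \<phi> (D z) x y + \<phi> (D z) x y = 0" for x y z
  proof -
    have "\<phi> (D z) x y = \<phi> x y (D z)" using cyc[of x y "D z"] by simp
    also have "\<dots> = - bracket (D z) (bracket (D x) y)"
      unfolding \<phi>_def by (rule bracket_skew)
    also have "\<dots> = - (\<phi> z (D x) y + \<phi> z (D x) y)" by (simp add: eng2)
    also have "\<phi> z (D x) y = \<phi> (D z) x y" by (simp add: \<phi>_def Dadj)
    finally show ?thesis by (simp add: algebra_simps eq_neg_iff_add_eq_0)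
  qed
  have "\<phi> x y z = 0" for x y z
  proof -
    \<comment> \<open>For x = \<alpha> v the value is f + g, where 4f = -g by \<open>D3\<close> and
      3g = 0 by \<open>D2\<close>; hence 4(f + g) = 3g = 0. Halving twice is where characteristic
      different from 2 enters.\<close>
    obtain v where v: "x = \<alpha> v" using surj by blast
    let ?f = "\<phi> v y z" and ?g = "\<phi> (D v) y z"
    have xx: "\<phi> x y z = ?f + ?g" by (simp add: v \<phi>_def \<alpha>D Dadd bracket_simps)
    have "(?f + ?g) + (?f + ?g) + ((?f + ?g) + (?f + ?g))
        = (?f + ?f + ?f + ?f) + ?g + (?g + ?g + ?g)" by (simp add: algebra_simps)
    also have "\<dots> = 0" using D3[of v y z] D2[of v y z] by simp
    finally show ?thesis unfolding xx by (rule double_eq_zero[OF two, OF double_eq_zero[OF two]])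
  qed
  then show "bracket (bracket (\<alpha> x - x) y) z = 0" and "bracket (\<alpha> x - x) (bracket y z) = 0"
    using eng2[of x y z] by (simp_all add: \<phi>_def D_def)
qed

section \<open>Dimension count and generators in coclass 2\<close>

lemma lower_central_dim_ge:
  assumes "has_dimension n" and "has_nilpotency_class c" and "k \<le> c"
  shows "k \<le> dim (lower_central (c - k))"
proof -
  obtain B where B: "finite B" "independent B" "span B = UNIV"
    using assms(1) by (auto simp: has_dimension_def)
  interpret fd: finite_dimensional_vector_space scale B by unfold_locales (use B in auto)
  show ?thesis using assms(3)
  proof (induction k)
    case (Suc k)
    let ?i = "c - Suc k"
    have S: "Suc ?i = c - k" using Suc.prems by simp
    \<comment> \<open>Below level \<open>c\<close> every inclusion is strict, since stabilising at
      \<open>?i\<close> would force the term at c - 1 to vanish. Thus each step down from level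
      \<open>c\<close> gains a dimension.\<close>
    have "\<not> lower_central ?i \<subseteq> lower_central (Suc ?i)"
    proof
      assume "lower_central ?i \<subseteq> lower_central (Suc ?i)"
      then have "lower_central ?i = {0}"
        using lower_central_stable assms(2) unfolding has_nilpotency_class_def by blast
      then have "lower_central (c - 1) \<subseteq> {0}" using lower_central_antimono[of ?i "c - 1"] by simp
      then show False using assms(2) zero_in_lower_central unfolding has_nilpotency_class_def by blast
    qed
    then have "lower_central (Suc ?i) \<subset> lower_central ?i" using lower_central_Suc_subset by blast
    then have "dim (lower_central (Suc ?i)) < dim (lower_central ?i)"
      by (intro fd.dim_psubset) (simp add: span_eq_iff[THEN iffD2] subspace_lower_central del: lower_central.simps)
    with Suc S show ?case by simp
  qed simp
qed

text \<open>Since dim L^2 \<ge> c - 2, the quotient L/L^2 has dimension at most 4. Some bracket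
  [p, q] lies outside L^2, and p, q, [p, q] are independent modulo L^2, so there is room for at most
  one further direction, \<open>w\<close>.\<close>

lemma coclass_two_generators:
  assumes n: "has_dimension (c + 2)" and c: "has_nilpotency_class c" and c2: "2 \<le> c"
  obtains p q w where
    "bracket p q \<notin> lower_central 2"
    "\<forall>x. \<exists>a b d. x - (scale a p + scale b q + scale d w) \<in> lower_central 1"
    "\<forall>l\<in>lower_central 1. \<exists>s. l - scale s (bracket p q) \<in> lower_central 2"
    "\<forall>y. bracket w y \<in> lower_central 2"
proof -
  obtain B where B: "finite B" "independent B" "span B = UNIV" "card B = c + 2"
    using n by (auto simp: has_dimension_def)
  interpret fd: finite_dimensional_vector_space scale B by unfold_locales (use B in auto)
  let ?L1 = "lower_central 1" and ?L2 = "lower_central 2"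
  have s1: "subspace ?L1" and s2: "subspace ?L2" by (rule subspace_lower_central)+
  have L21: "?L2 \<subseteq> ?L1" by (rule lower_central_antimono) simp
  have br1: "bracket x y \<in> ?L1" for x y using bracket_mem_derived[of x y] by simp
  have br2: "bracket x l \<in> ?L2" "bracket l x \<in> ?L2" if "l \<in> ?L1" for x l
    using bracket_mem_right[of l 1 x] bracket_mem_left[of l 1 x] that by (simp_all only: Suc_1)
  have dimL: "dim (UNIV :: 'v set) = c + 2" using n by (rule dim_unique)
  have dim2: "c \<le> dim ?L2 + 2" using lower_central_dim_ge[OF n c, of "c - 2"] c2 by simp
  have "\<not> ?L1 \<subseteq> ?L2"
  proof
    assume "?L1 \<subseteq> ?L2"
    then have "?L1 = {0}" using lower_central_stable[of c 1] c
      by (simp only: Suc_1 has_nilpotency_class_def)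
    then show False using c c2 lower_central_antimono[of 1 "c - 1"] zero_in_lower_central[of "c - 1"]
      unfolding has_nilpotency_class_def by (metis One_nat_def Suc_1 Suc_leD diff_le_mono diff_Suc_1 subset_singletonD empty_iff)
  qed
  then obtain p q where pq: "bracket p q \<notin> ?L2"
    using lower_central_Suc_least[of ?L2 0] s2 by auto
  define e where "e = bracket p q"
  have e1: "e \<in> ?L1" and e2: "e \<notin> ?L2" using pq br1 by (auto simp: e_def)
  \<comment> \<open>Bracketing with \<open>q\<close> isolates \<open>a\<close> times
    \<open>e\<close>, bracketing with \<open>p\<close> isolates \<open>b\<close> times
    \<open>e\<close>. Both land in L^2, which does not contain \<open>e\<close>.\<close>
  have indep: "a = 0 \<and> b = 0" if "scale a p + scale b q \<in> ?L1" for a b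
  proof -
    have "scale a e \<in> ?L2" using br2(2)[OF that, of q] by (simp add: bracket_simps e_def)
    moreover have "scale b e \<in> ?L2" using br2(1)[OF that, of p] by (simp add: bracket_simps e_def)
    ultimately show ?thesis using e2 subspace_scale[OF s2]
      by (metis scale_one scale_scale left_inverse)
  qed
  \<comment> \<open>\<open>?U\<close> has dimension at least c + 1, hence codimension at most 1, and
    lies in \<open>?P\<close>. If \<open>?P\<close> is proper, the two coincide; this forces L' into
    \<open>?U\<close>.\<close>
  let ?U = "span (insert q (insert p (insert e ?L2)))"
  let ?P = "span (insert q (insert p ?L1))"
  have s2': "span ?L2 = ?L2" and s1': "span ?L1 = ?L1" using s1 s2 by (simp_all add: span_eq_iff del: lower_central.simps)
  have i1: "e \<notin> span ?L2" unfolding s2' by (rule e2)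
  have eL: "span (insert e ?L2) \<subseteq> ?L1"
    by (rule span_minimal) (use e1 L21 s1 in auto)
  have i2: "p \<notin> span (insert e ?L2)"
  proof
    assume "p \<in> span (insert e ?L2)"
    then show False using eL indep[of 1 0] by auto
  qed
  have i3: "q \<notin> span (insert p (insert e ?L2))"
  proof
    assume "q \<in> span (insert p (insert e ?L2))"
    then obtain k where "q - scale k p \<in> span (insert e ?L2)" by (auto simp: span_breakdown_eq)
    then show False using eL indep[of "-k" 1] by (auto simp: algebra_simps)
  qed
  have dimU: "dim ?U = dim ?L2 + 3"
    unfolding dim_span by (simp add: fd.dim_insert i1 i2 i3 del: lower_central.simps)
  have UP: "?U \<subseteq> ?P"
    by (intro span_minimal) (use e1 L21 in \<open>auto intro: span_base simp del: lower_central.simps\<close>)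
  have Pdec: "\<exists>a b. x - (scale a p + scale b q) \<in> ?L1" if "x \<in> ?P" for x
    using that unfolding span_breakdown_eq s1' by (metis diff_diff_eq add.commute)
  have Udec: "\<exists>s. l - scale s e \<in> ?L2" if lU: "l \<in> ?U" and l1: "l \<in> ?L1" for l
  proof -
    obtain b a s where m: "l - scale b q - scale a p - scale s e \<in> ?L2"
      using lU unfolding span_breakdown_eq s2' by blast
    then have "l - (l - scale b q - scale a p - scale s e) - scale s e \<in> ?L1"
      using subspace_diff[OF s1 subspace_diff[OF s1 l1 subsetD[OF L21 m]] subspace_scale[OF s1 e1]]
      by blast
    then have "scale a p + scale b q \<in> ?L1" by (simp add: algebra_simps)
    then have "a = 0" "b = 0" using indep by auto
    then show ?thesis using m by auto
  qed
  obtain w where w: "\<And>x. \<exists>a b d. x - (scale a p + scale b q + scale d w) \<in> ?L1"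
    and L1: "\<And>l. l \<in> ?L1 \<Longrightarrow> \<exists>s. l - scale s e \<in> ?L2"
  proof (cases "?P = UNIV")
    case True
    have dec: "\<exists>a b. x - (scale a p + scale b q) \<in> ?L1" for x using Pdec True by auto
    let ?S = "span (insert e ?L2)"
    have "bracket x y \<in> ?S" for x y
    proof -
      obtain a b where x: "x - (scale a p + scale b q) \<in> ?L1" using dec by blast
      obtain a' b' where y: "y - (scale a' p + scale b' q) \<in> ?L1" using dec by blast
      \<comment> \<open>Modulo L^2 only the coordinates along \<open>p\<close> and \<open>q\<close>
        contribute, and they enter through a determinant times \<open>e\<close>.\<close>
      have "bracket x y = bracket (x - (scale a p + scale b q)) y
          + bracket (scale a p + scale b q) (y - (scale a' p + scale b' q))
          + scale (a * b' - b * a') e"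
        using bracket_skew[of q p]
        by (simp add: bracket_simps e_def algebra_simps)
      also have "\<dots> \<in> ?S"
        using br2 x y by (intro span_add span_scale) (auto intro: span_base simp del: lower_central.simps)
      finally show ?thesis .
    qed
    then have "lower_central (Suc 0) \<subseteq> ?S" by (intro lower_central_Suc_least) auto
    then have "?L1 \<subseteq> ?U" using span_mono[of "insert e ?L2" "insert q (insert p (insert e ?L2))"]
      by (simp only: One_nat_def) blast
    then have "\<And>l. l \<in> ?L1 \<Longrightarrow> \<exists>s. l - scale s e \<in> ?L2" using Udec by blast
    \<comment> \<open>No third generator is present here, and w = 0 serves as a placeholder.\<close>
    moreover have "\<exists>a b d. x - (scale a p + scale b q + scale d 0) \<in> ?L1" for x
      using dec[of x] by simp
    ultimately show ?thesis using that by blast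
  next
    case False
    then obtain w where w: "w \<notin> ?P" by auto
    have "dim (insert w ?P) = dim ?P + 1" using w unfolding fd.dim_insert span_span by simp
    moreover have "dim (insert w ?P) \<le> dim (UNIV :: 'v set)" by (rule fd.dim_subset) simp
    ultimately have "dim ?P \<le> dim ?U" using dimU dimL dim2 by linarith
    then have PU: "?P = ?U" using UP fd.subspace_dim_equal[of ?U ?P] by simp
    have "dim (insert w ?P) \<ge> c + 2"
      using dimU dim2 PU \<open>dim (insert w ?P) = dim ?P + 1\<close> by simp
    then have "dim (insert w ?P) = fd.dimension"
      using dimL B(4) \<open>dim (insert w ?P) \<le> dim (UNIV :: 'v set)\<close>
      unfolding fd.dimension_def by linarith
    then have "span (insert w ?P) = UNIV" by (simp only: fd.dim_eq_full)
    then have "\<exists>d. x - scale d w \<in> ?P" for x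
      using span_breakdown_eq[of x w ?P] by (simp add: span_span)
    then have "\<exists>a b d. x - (scale a p + scale b q + scale d w) \<in> ?L1" for x
      using Pdec by (metis diff_diff_eq add.commute)
    moreover have "\<exists>s. l - scale s e \<in> ?L2" if "l \<in> ?L1" for l
    proof -
      have "l \<in> ?P" using that by (auto intro: span_base simp del: lower_central.simps)
      then show ?thesis using Udec that PU by auto
    qed
    ultimately show ?thesis using that by blast
  qed
  obtain s where s: "bracket w p - scale s e \<in> ?L2" using L1 br1 by blast
  obtain t where t: "bracket w q - scale t e \<in> ?L2" using L1 br1 by blast
  \<comment> \<open>The correction cancels the \<open>e\<close>-components of [w, p] and [w, q],
    because [p, q] = e and [q, p] = -e.\<close>
  define w' where "w' = w - scale t p + scale s q"
  have w'p: "bracket w' p \<in> ?L2" using s bracket_skew[of q p]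
    by (simp add: w'_def bracket_simps e_def)
  have w'q: "bracket w' q \<in> ?L2" using t
    by (simp add: w'_def bracket_simps e_def)
  have w'dec: "\<exists>a b d. x - (scale a p + scale b q + scale d w') \<in> ?L1" for x
  proof -
    obtain a b d where "x - (scale a p + scale b q + scale d w) \<in> ?L1" using w by blast
    then have "x - (scale (a + d * t) p + scale (b - d * s) q + scale d w') \<in> ?L1"
      by (simp add: w'_def algebra_simps)
    then show ?thesis by blast
  qed
  have "bracket w' y \<in> ?L2" for y
  proof -
    obtain a b d where y: "y - (scale a p + scale b q + scale d w') \<in> ?L1" using w'dec by blast
    have "bracket w' y = bracket w' (y - (scale a p + scale b q + scale d w'))
       + (scale a (bracket w' p) + scale b (bracket w' q))" by (simp add: bracket_simps)
    also have "\<dots> \<in> ?L2"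
      using y br2 w'p w'q s2 by (intro subspace_add subspace_scale) auto
    finally show ?thesis .
  qed
  then show ?thesis using that[of p q w'] pq w'dec L1 unfolding e_def by blast
qed

section \<open>Displacements modulo the derived algebra\<close>

text \<open>Modulo L^2, brackets with \<open>p\<close> and \<open>q\<close> read off the coordinates
  of an element along \<open>q\<close> and \<open>p\<close>. Through them \<open>D\<close> is seen
  to act as a scalar \<open>a\<close> modulo \<langle>w\<rangle> + L'; the alternatives are a = 0
  and a \<noteq> 0.\<close>

lemma displacement_dichotomy:
  assumes c: "lower_central c = {0}"
    and pq: "bracket p q \<notin> lower_central 2"
    and dec: "\<forall>x. \<exists>a b d. x - (scale a p + scale b q + scale d w) \<in> lower_central 1"
    and L1: "\<forall>l\<in>lower_central 1. \<exists>s. l - scale s (bracket p q) \<in> lower_central 2"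
    and w: "\<forall>y. bracket w y \<in> lower_central 2"
    and adj: "\<And>x y. bracket (D x) y = bracket x (D y)"
    and self: "\<And>x. bracket (D x) x = 0"
    and D2: "\<And>x y z. bracket (bracket (D x) y) z = 0"
  shows "(\<forall>x. \<exists>d. D x - scale d w \<in> lower_central 1) \<or>
    (\<exists>r. \<forall>x y. bracket (D x) y = scale r (bracket x y))"
proof -
  let ?L1 = "lower_central 1" and ?L2 = "lower_central 2"
  define e where "e = bracket p q"
  have s2: "subspace ?L2" by (rule subspace_lower_central)
  have br2: "bracket x l \<in> ?L2" "bracket l x \<in> ?L2" if "l \<in> ?L1" for x l
    using bracket_mem_right[of l 1 x] bracket_mem_left[of l 1 x] that by (simp_all only: Suc_1)
  have e0: "a = 0" if "scale a e \<in> ?L2" for a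
  proof (rule ccontr)
    assume "a \<noteq> 0"
    then have "scale (inverse a) (scale a e) = e" by simp
    then show False using pq subspace_scale[OF s2 that, of "inverse a"] by (simp add: e_def)
  qed
  have R: "bracket x y \<in> ?L2" "bracket y x \<in> ?L2" if "x - scale d w \<in> ?L1" for x y d
  proof -
    have "bracket x y = bracket (x - scale d w) y + scale d (bracket w y)"
      by (simp add: bracket_simps)
    also have "\<dots> \<in> ?L2" using br2 that w s2 by (intro subspace_add subspace_scale) auto
    finally show "bracket x y \<in> ?L2" .
    then show "bracket y x \<in> ?L2" using bracket_skew[of y x] subspace_neg[OF s2] by metis
  qed
  have coeff: "bracket x q - scale a e \<in> ?L2 \<and> bracket x p + scale b e \<in> ?L2"
    if "x - (scale a p + scale b q + scale d w) \<in> ?L1" for x a b d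
  proof -
    have "(x - (scale a p + scale b q)) - scale d w \<in> ?L1" using that by (simp add: algebra_simps)
    note R(1)[OF this, of q] R(1)[OF this, of p]
    then show ?thesis using bracket_skew[of q p] by (simp add: bracket_simps e_def algebra_simps)
  qed
  have K: "\<exists>d. x - scale d w \<in> ?L1" if "bracket x p \<in> ?L2" "bracket x q \<in> ?L2" for x
  proof -
    obtain a b d where x: "x - (scale a p + scale b q + scale d w) \<in> ?L1" using dec by blast
    then have "bracket x q - (bracket x q - scale a e) \<in> ?L2"
      "(bracket x p + scale b e) - bracket x p \<in> ?L2"
      using coeff[OF x] that subspace_diff[OF s2] by blast+
    then have "a = 0" "b = 0" using e0 by auto
    then show ?thesis using x by auto
  qed
  obtain a b d where Dp: "D p - (scale a p + scale b q + scale d w) \<in> ?L1" using dec by blast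
  obtain a' b' d' where Dq: "D q - (scale a' p + scale b' q + scale d' w) \<in> ?L1" using dec by blast
  \<comment> \<open>The matrix of \<open>D\<close> on p, q is diagonal because [D p, p] = [D q, q] =
    0. Its diagonal entries agree because [D p, q] = [p, D q].\<close>
  have "b = 0" using coeff[OF Dp] self[of p] e0 by simp
  have "scale (- a') e \<in> ?L2" using coeff[OF Dq] self[of q] by simp
  then have "a' = 0" using e0[of "- a'"] by simp
  have "bracket (D q) p = - bracket (D p) q"
    using adj[of p q] bracket_skew[of p "D q"] by simp
  then have "scale (b' - a) e = (bracket (D p) q - scale a e) + (bracket (D q) p + scale b' e)"
    by (simp add: algebra_simps)
  also have "\<dots> \<in> ?L2" using coeff[OF Dp] coeff[OF Dq] subspace_add[OF s2] by blast
  finally have "b' = a" using e0 by fastforce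
  have Dpa: "(D p - scale a p) - scale d w \<in> ?L1" using Dp \<open>b = 0\<close> by (simp add: algebra_simps)
  have Dqa: "(D q - scale a q) - scale d' w \<in> ?L1" using Dq \<open>a' = 0\<close> \<open>b' = a\<close>
    by (simp add: algebra_simps)
  \<comment> \<open>D - a is self-adjoint too, so its brackets with \<open>p\<close> and
    \<open>q\<close> can be evaluated on (D - a) p and (D - a) q, and \<open>K\<close>
    applies.\<close>
  have Dxa: "\<exists>d. (D x - scale a x) - scale d w \<in> ?L1" for x
  proof (rule K)
    have "bracket (D x - scale a x) y = bracket x (D y - scale a y)" for y
      by (simp add: bracket_simps adj)
    then show "bracket (D x - scale a x) p \<in> ?L2" "bracket (D x - scale a x) q \<in> ?L2"
      using R(2)[OF Dpa] R(2)[OF Dqa] by simp_all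
  qed
  show ?thesis
  proof (cases "a = 0")
    case True
    then show ?thesis using Dxa by simp
  next
    case False
    \<comment> \<open>Modulo L^2, \<open>e\<close> is [D p, q] divided by \<open>a\<close>, and
      [D p, q] is central by \<open>D2\<close>. So \<open>l\<close> may be replaced by an element of
      L^2 without changing its brackets. Hence L^2 = L^3, and nilpotency gives L^2 = 0.\<close>
    have "bracket x l \<in> lower_central 3" if l: "l \<in> ?L1" for x l
    proof -
      obtain s where s: "l - scale s e \<in> ?L2" using L1 l unfolding e_def by blast
      have "bracket (D p) q - scale a e \<in> ?L2" using coeff[OF Dp] by simp
      then have m: "(l - scale s e) - scale (s / a) (bracket (D p) q - scale a e) \<in> ?L2"
        by (rule subspace_diff[OF s2 s subspace_scale[OF s2]])
      have "bracket x l = bracket x ((l - scale s e) - scale (s / a) (bracket (D p) q - scale a e))"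
        using False D2[of p q x] bracket_skew[of x "bracket (D p) q"] by (simp add: bracket_simps)
      then show ?thesis using bracket_mem_right[OF m, of x] by (simp add: numeral_3_eq_3 numeral_2_eq_2)
    qed
    then have "lower_central (Suc 1) \<subseteq> lower_central 3"
      by (intro lower_central_Suc_least subspace_lower_central) auto
    then have "?L2 = {0}" by (intro lower_central_stable[OF c]) (simp add: numeral_3_eq_3 numeral_2_eq_2)
    then have "bracket (D x - scale a x) y = 0" for x y using R(1) Dxa by blast
    then show ?thesis by (auto simp: bracket_simps)
  qed
qed

lemma displacements_commute:
  assumes two: "(2::'f) \<noteq> 0" and co: "has_coclass 2"
    and \<alpha>: "\<alpha> \<in> commuting_automorphisms" and \<beta>: "\<beta> \<in> commuting_automorphisms"
  shows "bracket (\<alpha> x - x) (\<beta> x - x) = 0"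
proof -
  obtain c where n: "has_dimension (c + 2)" and c: "has_nilpotency_class c"
    using co by (auto simp: has_coclass_def)
  have c0: "lower_central c = {0}" and "c \<noteq> 0"
    using c unfolding has_nilpotency_class_def by (blast, metis zero_diff)
  show ?thesis
  proof (cases "c = 1")
    case True
    then show ?thesis
      using c0 bracket_mem_derived[of "\<alpha> x - x" "\<beta> x - x"] by (simp only: One_nat_def) blast
  next
    case False
    with \<open>c \<noteq> 0\<close> have c2: "2 \<le> c" by simp
    obtain p q w where g: "bracket p q \<notin> lower_central 2"
      "\<forall>x. \<exists>a b d. x - (scale a p + scale b q + scale d w) \<in> lower_central 1"
      "\<forall>l\<in>lower_central 1. \<exists>s. l - scale s (bracket p q) \<in> lower_central 2"
      "\<forall>y. bracket w y \<in> lower_central 2"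
      by (rule coclass_two_generators[OF n c c2])
    have self: "bracket (\<gamma> x - x) x = 0" if "\<gamma> \<in> commuting_automorphisms" for \<gamma> x
      using that by (simp add: commuting_automorphisms_def bracket_simps)
    have cases: "(\<exists>d. \<gamma> x - x - scale d w \<in> lower_central 1) \<or>
        (\<exists>r. \<forall>y. bracket (\<gamma> x - x) y = scale r (bracket x y))"
      if \<gamma>: "\<gamma> \<in> commuting_automorphisms" for \<gamma>
    proof -
      have adj: "bracket (\<gamma> x - x) y = bracket x (\<gamma> y - y)" for x y
        using commuting_adjoint[OF \<gamma>, of x y] by (simp add: bracket_simps)
      have "(\<forall>x. \<exists>d. \<gamma> x - x - scale d w \<in> lower_central 1) \<or>
          (\<exists>r. \<forall>x y. bracket (\<gamma> x - x) y = scale r (bracket x y))"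
        by (rule displacement_dichotomy[where D = "\<lambda>x. \<gamma> x - x", OF c0 g adj self[OF \<gamma>]
            commuting_displacement(1)[OF two \<gamma>]])
      then show ?thesis by blast
    qed
    let ?D = "\<alpha> x - x" and ?E = "\<beta> x - x"
    have Dl: "bracket l (\<gamma> x - x) = 0"
      if "\<gamma> \<in> commuting_automorphisms" "l \<in> lower_central 1" for \<gamma> l
    proof -
      have "lower_central (Suc 0) \<subseteq> {l. bracket l (\<gamma> x - x) = 0}"
      proof (rule lower_central_Suc_least)
        show "subspace {l. bracket l (\<gamma> x - x) = 0}"
          by (auto simp: subspace_def bracket_add_left bracket_scale_left)
        show "bracket y l \<in> {l. bracket l (\<gamma> x - x) = 0}" for y l
          using commuting_displacement(2)[OF two that(1), of x y l]
            bracket_skew[of "bracket y l" "\<gamma> x - x"] by simp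
      qed
      then show ?thesis using that(2) by auto
    qed
    consider (R) d d' where "?D - scale d w \<in> lower_central 1" "?E - scale d' w \<in> lower_central 1"
      | (A) r where "\<And>y. bracket ?D y = scale r (bracket x y)"
      | (B) r where "\<And>y. bracket ?E y = scale r (bracket x y)"
      using cases[OF \<alpha>] cases[OF \<beta>] by blast
    then show ?thesis
    proof cases
      case R
      show ?thesis
      \<comment> \<open>If d' = 0, then \<open>?E\<close> is in L' and is annihilated by
        \<open>?D\<close>. Otherwise a multiple of \<open>?E\<close> removes the
        \<open>w\<close>-component of \<open>?D\<close>, and the remainder, lying in L', is
        annihilated by \<open>?E\<close>.\<close>
      proof (cases "d' = 0")
        case True
        then show ?thesis using Dl[OF \<alpha>, of ?E] R(2) bracket_skew[of ?D ?E] by simp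
      next
        case False
        have "(?D - scale d w) - scale (d / d') (?E - scale d' w) \<in> lower_central 1"
          by (rule subspace_diff[OF subspace_lower_central R(1)
            subspace_scale[OF subspace_lower_central R(2)]])
        then have "?D - scale (d / d') ?E \<in> lower_central 1"
          using False by (simp add: scale_right_diff_distrib)
        then have "bracket (?D - scale (d / d') ?E) ?E = 0" by (rule Dl[OF \<beta>])
        then have "bracket ?D ?E = scale (d / d') (bracket ?E ?E)"
          by (simp only: bracket_diff_left[of ?D] bracket_scale_left right_minus_eq)
        then show ?thesis by (simp only: bracket_self scale_zero_right)
      qed
    next
      case A
      then show ?thesis using self[OF \<beta>, of x] bracket_skew[of x ?E] by simp
    next
      case B
      then show ?thesis using self[OF \<alpha>, of x] bracket_skew[of x ?D] bracket_skew[of ?D ?E] by simp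
    qed
  qed
qed

section \<open>Closure and the subgroup property\<close>

lemma commuting_automorphisms_comp:
  assumes "(2::'f) \<noteq> 0" and "has_coclass 2"
    and \<alpha>: "\<alpha> \<in> commuting_automorphisms" and \<beta>: "\<beta> \<in> commuting_automorphisms"
  shows "\<alpha> \<circ> \<beta> \<in> commuting_automorphisms"
proof -
  have self: "bracket (\<gamma> x) x = 0" if "\<gamma> \<in> commuting_automorphisms" for \<gamma> x
    using that by (simp add: commuting_automorphisms_def)
  have "bracket (\<alpha> (\<beta> x)) x = 0" for x
  proof -
    \<comment> \<open>Self-adjointness turns [\<alpha>(\<beta> x), x] into [\<beta> x, \<alpha> x].
      As \<open>x\<close> commutes with both images, this differs from the bracket of the two
      displacements only in vanishing terms.\<close>
    have "bracket (\<beta> x) (\<alpha> x) = 0"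
      using displacements_commute[OF assms, of x] self[OF \<alpha>, of x] self[OF \<beta>, of x]
        bracket_skew[of "\<alpha> x" "\<beta> x"] bracket_skew[of x "\<beta> x"] by (simp add: bracket_simps)
    then show ?thesis using commuting_adjoint[OF \<alpha>] by simp
  qed
  moreover have "\<alpha> \<circ> \<beta> \<in> automorphisms"
    using \<alpha> \<beta> group.is_monoid[OF group_automorphism_group, THEN monoid.m_closed, of \<alpha> \<beta>]
    by (simp add: automorphism_group_def commuting_automorphisms_def)
  ultimately show ?thesis by (simp add: commuting_automorphisms_def)
qed

lemma commuting_automorphisms_inv:
  assumes "\<alpha> \<in> commuting_automorphisms"
  shows "inv_into UNIV \<alpha> \<in> commuting_automorphisms"
proof -
  have aut: "\<alpha> \<in> automorphisms" using assms by (simp add: commuting_automorphisms_def)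
  then have right: "\<alpha> (inv_into UNIV \<alpha> x) = x" for x
    by (simp add: automorphisms_def bij_is_surj surj_f_inv_f)
  have "bracket (inv_into UNIV \<alpha> x) x = 0" for x
    using assms commuting_adjoint[OF assms, of "inv_into UNIV \<alpha> x" "inv_into UNIV \<alpha> x"]
    by (auto simp: commuting_automorphisms_def right dest: spec[of _ "inv_into UNIV \<alpha> x"])
  then show ?thesis using automorphisms_inv[OF aut] by (simp add: commuting_automorphisms_def)
qed

lemma automorphism_group_inv:
  assumes "\<alpha> \<in> automorphisms"
  shows "inv\<^bsub>automorphism_group\<^esub> \<alpha> = inv_into UNIV \<alpha>"
proof (rule group.inv_equality[OF group_automorphism_group])
  show "inv_into UNIV \<alpha> \<otimes>\<^bsub>automorphism_group\<^esub> \<alpha> = \<one>\<^bsub>automorphism_group\<^esub>"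
    using assms by (simp add: automorphism_group_def automorphisms_def bij_is_inj)
qed (use assms automorphisms_inv in \<open>auto simp: automorphism_group_def\<close>)

lemma subgroup_commuting_automorphisms:
  assumes "(2::'f) \<noteq> 0" and "has_coclass 2"
  shows "subgroup commuting_automorphisms automorphism_group"
proof (rule group.subgroupI[OF group_automorphism_group])
  show "commuting_automorphisms \<subseteq> carrier automorphism_group"
    by (auto simp: commuting_automorphisms_def automorphism_group_def)
  have "id \<in> commuting_automorphisms"
    by (simp add: commuting_automorphisms_def automorphisms_def linear_id bracket_self)
  then show "commuting_automorphisms \<noteq> {}" by blast
  show "inv\<^bsub>automorphism_group\<^esub> \<alpha> \<in> commuting_automorphisms"
    if "\<alpha> \<in> commuting_automorphisms" for \<alpha>
    using that commuting_automorphisms_inv automorphism_group_inv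
    by (simp add: commuting_automorphisms_def)
  show "\<alpha> \<otimes>\<^bsub>automorphism_group\<^esub> \<beta> \<in> commuting_automorphisms"
    if "\<alpha> \<in> commuting_automorphisms" "\<beta> \<in> commuting_automorphisms" for \<alpha> \<beta>
    using commuting_automorphisms_comp[OF assms that] by (simp add: automorphism_group_def)
qed

end

theorem theorem5p1:
  fixes scale :: "'f::field \<Rightarrow> 'v::ab_group_add \<Rightarrow> 'v"
    and bracket :: "'v \<Rightarrow> 'v \<Rightarrow> 'v"
    and n :: nat
  assumes "CHAR('f) \<noteq> 2"
    and "lie_algebra scale bracket"
    and "lie_algebra.has_dimension scale n"
    and "lie_algebra.nilpotent scale bracket"
    and "lie_algebra.has_coclass scale bracket 2"
  shows "subgroup (lie_algebra.commuting_automorphisms scale bracket)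
           (lie_algebra.automorphism_group scale bracket)"
proof -
  have "(2::'f) \<noteq> 0"
  proof
    assume "(2::'f) = 0"
    \<comment> \<open>The characteristic divides 2, so it is 1 or 2, and 1 is impossible in a
      field.\<close>
    then have "CHAR('f) dvd 2" using of_nat_eq_0_iff_char_dvd[where 'a = 'f, of 2] by simp
    then have "CHAR('f) \<le> 2" and "CHAR('f) \<noteq> 0"
      by (auto dest: dvd_imp_le) (metis dvd_0_left_iff zero_neq_numeral neq0_conv)
    moreover have "CHAR('f) \<noteq> 1" by simp
    ultimately show False using assms(1) by linarith
  qed
  then show ?thesis
    using lie_algebra.subgroup_commuting_automorphisms[OF assms(2)] assms(5) by blast
qed

end
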